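(* Let $G$ be a finite graph of order $n$ in which every connected component contains at least three vertices. Then $$\gamma_{tg}(G) \le \frac{11}{14}\,n.$$
   Context: For a graph $G$ and a vertex $v$, $N_G(v)=\{u: uv\in E(G)\}$ is the open neighborhood of $v$. A vertex $v$ totally dominates $u$ if $u\in N_G(v)$. A set $D\subseteq V(G)$ is a total dominating set if every vertex of $G$ has a neighbor in $D$. The total domination game is played on a graph $G$ with no isolated vertices by two players, Dominator and Staller, who alternately select vertices of $G$, with Dominator moving first. A move is legal only if the chosen vertex totally dominates at least one vertex that is not totally dominated by the set of previously chosen vertices. The game ends when the set of chosen vertices is a total dominating set of $G$. Dominator wants to minimize the number of vertices chosen, Staller wants to maximize it. The game total domination number $\gamma_{tg}(G)$ is the number of vertices chosen when Dominator starts and both players play optimally. *)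

theory Defs
  imports Complex_Main "Graph_Theory.Graph_Theory"
begin

text \<open>
  Finite simple graphs are the symmetric loop-free digraphs without parallel arcs
  of the locale \<^locale>\<open>graph\<close>. An edge \<open>uv\<close> is the pair of opposite arcs
  between \<open>u\<close> and \<open>v\<close>, so the strongly connected components
  (\<^const>\<open>pre_digraph.sccs\<close>) of such a digraph are the connected components of the graph.
\<close>

definition open_nbhd :: "('a, 'b) pre_digraph \<Rightarrow> 'a \<Rightarrow> 'a set" where
  "open_nbhd G v = {u. u \<rightarrow>\<^bsub>G\<^esub> v}"

definition totally_dominates :: "('a, 'b) pre_digraph \<Rightarrow> 'a \<Rightarrow> 'a \<Rightarrow> bool" where
  "totally_dominates G v u \<longleftrightarrow> u \<in> open_nbhd G v"

definition total_dominating_set :: "('a, 'b) pre_digraph \<Rightarrow> 'a set \<Rightarrow> bool" where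
  "total_dominating_set G D \<longleftrightarrow> D \<subseteq> verts G \<and> (\<forall>u \<in> verts G. \<exists>v \<in> D. v \<in> open_nbhd G u)"

definition legal_moves :: "('a, 'b) pre_digraph \<Rightarrow> 'a set \<Rightarrow> 'a set" where
  "legal_moves G D =
    {v \<in> verts G. \<exists>u \<in> verts G. totally_dominates G v u \<and> \<not> (\<exists>d \<in> D. totally_dominates G d u)}"

datatype player = Dominator | Staller

text \<open>
  \<open>game_length G p D\<close> is the number of further moves under optimal play when the
  vertices in \<open>D\<close> have been chosen and \<open>p\<close> is to move. The conjuncts
  \<open>finite (verts G)\<close> and \<open>legal_moves G D \<noteq> {}\<close> only make the function total; the latter
  is automatic for an unfinished game without isolated vertices
  (lemma \<open>legal_moves_nonempty\<close>).
\<close>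

function game_length :: "('a, 'b) pre_digraph \<Rightarrow> player \<Rightarrow> 'a set \<Rightarrow> nat" where
  "game_length G p D =
    (if finite (verts G) \<and> \<not> total_dominating_set G D \<and> legal_moves G D \<noteq> {}
     then Suc (case p of
       Dominator \<Rightarrow> (MIN v \<in> legal_moves G D. game_length G Staller (insert v D))
     | Staller \<Rightarrow> (MAX v \<in> legal_moves G D. game_length G Dominator (insert v D)))
     else 0)"
  by pat_completeness auto
termination
proof (relation "measure (\<lambda>(G, p, D). card (verts G - D))")
  have "card (verts G - insert v D) < card (verts G - D)"
    if "finite (verts G)" "v \<in> legal_moves G D" for G :: "('a, 'b) pre_digraph" and v D
  proof (rule psubset_card_mono)
    show "verts G - insert v D \<subset> verts G - D"
      using that(2) unfolding legal_moves_def by auto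
  qed (use that(1) in simp)
  then show
    "\<And>G p D v. finite (verts G) \<and> \<not> total_dominating_set G D \<and> legal_moves G D \<noteq> {} \<Longrightarrow>
      p = Dominator \<Longrightarrow> v \<in> legal_moves G D \<Longrightarrow>
      ((G :: ('a, 'b) pre_digraph, Staller, insert v D), (G, p, D))
        \<in> measure (\<lambda>(G, p, D). card (verts G - D))"
    "\<And>G p D v. finite (verts G) \<and> \<not> total_dominating_set G D \<and> legal_moves G D \<noteq> {} \<Longrightarrow>
      p = Staller \<Longrightarrow> v \<in> legal_moves G D \<Longrightarrow>
      ((G :: ('a, 'b) pre_digraph, Dominator, insert v D), (G, p, D))
        \<in> measure (\<lambda>(G, p, D). card (verts G - D))"
    by auto
qed simp

declare game_length.simps [simp del]

definition game_total_domination_number :: "('a, 'b) pre_digraph \<Rightarrow> nat" where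
  "game_total_domination_number G = game_length G Dominator {}"

lemma legal_moves_nonempty:
  assumes "graph G" and "\<And>v. v \<in> verts G \<Longrightarrow> open_nbhd G v \<noteq> {}"
    and "D \<subseteq> verts G" and "\<not> total_dominating_set G D"
  shows "legal_moves G D \<noteq> {}"
proof -
  interpret graph G by fact
  have swap: "a \<in> open_nbhd G b \<longleftrightarrow> b \<in> open_nbhd G a" for a b
    unfolding open_nbhd_def using arcs_ends_symmetric[OF sym_arcs] by auto
  obtain u where u: "u \<in> verts G" "\<forall>d \<in> D. d \<notin> open_nbhd G u"
    using assms(3,4) unfolding total_dominating_set_def by auto
  obtain v where v: "v \<in> open_nbhd G u" using assms(2)[OF u(1)] by auto
  then have "v \<in> verts G" unfolding open_nbhd_def by (auto dest: adj_in_verts)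
  then have "v \<in> legal_moves G D"
    using u v swap unfolding legal_moves_def totally_dominates_def by blast
  then show ?thesis by auto
qed

end

theory Submission
  imports Defs
begin

text \<open>
  A position is the set \<open>U\<close> of vertices that are not yet totally dominated. It gets a potential:
  5 for every vertex that is still playable, 6 for every vertex of \<open>U\<close>, and two corrections that
  protect pendant vertices. The initial potential is \<open>11 n\<close>, and Dominator makes the game consume
  on average at least 14 per move.

  If \<open>u\<close> is an undominated leaf at \<open>t\<close>, then an isolated pair \<open>u, t\<close> would be worth only 11
  although it costs one move, so it must be worth 3 more. This is paid as soon as \<open>t\<close> itself becomes
  dominated (\<open>t\<close> is then \<open>half\<close> instead of \<open>live\<close>), since at that moment the leaf \<open>u\<close> ceases to be
  playable and releases 5. The only move of Staller that releases fewer than 10 is the leaf \<open>u\<close>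
  itself at a live \<open>t\<close>; it releases at least 8, and Dominator's reply \<open>t\<close> releases 20 if it dominates
  a second vertex besides \<open>u\<close>.

  If Dominator has a move that releases 20, he plays it. If not, moves of 19 and 18 next to a live
  vertex suffice, because they leave positions in which every cheap move of Staller has a good reply.
  If there is none of those either, then all live vertices are centers of isolated stars of the
  domination relation, and a simpler potential, in which such a star gives 2 of its weight to its
  leaf, shows that 19 + 10 or 17 + 11 is released in each round.
\<close>

section \<open>Positions and their potential\<close>

text \<open>The order condition on components is used only through two local facts: no vertex is
  isolated (\<open>N_nonempty\<close>) and no component is a single edge
  (\<open>N_not_edge\<close>).\<close>

locale nbhd_system =
  fixes V :: "'a set" and N :: "'a \<Rightarrow> 'a set"
  assumes finite_V: "finite V"
    and N_subset: "N v \<subseteq> V"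
    and N_sym: "u \<in> N v \<Longrightarrow> v \<in> N u"
    and N_irrefl: "v \<notin> N v"
    and N_nonempty: "v \<in> V \<Longrightarrow> N v \<noteq> {}"
    and N_not_edge: "N v = {t} \<Longrightarrow> N t \<noteq> {v}"
begin

text \<open>A move costs 14 units of the budget \<open>c\<close>.\<close>

inductive affords :: "player \<Rightarrow> int \<Rightarrow> 'a set \<Rightarrow> bool" where
  finished: "0 \<le> c \<Longrightarrow> affords p c {}"
| dominator: "N w \<inter> U \<noteq> {} \<Longrightarrow> affords Staller (c - 14) (U - N w) \<Longrightarrow> affords Dominator c U"
| staller: "U \<noteq> {} \<Longrightarrow> (\<And>w. N w \<inter> U \<noteq> {} \<Longrightarrow> affords Dominator (c - 14) (U - N w))
    \<Longrightarrow> affords Staller c U"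

lemma affords_mono: "affords p c U \<Longrightarrow> c \<le> c' \<Longrightarrow> affords p c' U"
proof (induction arbitrary: c' rule: affords.induct)
  case (finished c p)
  then show ?case by (simp add: affords.finished)
next
  case (dominator w U c)
  then show ?case by (intro affords.dominator[of w]) auto
next
  case (staller U c)
  then show ?case by (intro affords.staller) auto
qed

definition leaves :: "'a \<Rightarrow> 'a set" where
  "leaves t = {u. N u = {t}}"

text \<open>
  The edge relation is read as a bipartite graph between playable vertices (\<open>movers\<close>) and undominated
  vertices; each vertex of the graph occurs on both sides.
\<close>

definition movers :: "'a set \<Rightarrow> 'a set" where
  "movers U = {w. N w \<inter> U \<noteq> {}}"

definition stems :: "'a set \<Rightarrow> 'a set" where
  "stems U = {t. leaves t \<inter> U \<noteq> {}}"

definition live :: "'a set \<Rightarrow> 'a set" where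
  "live U = stems U \<inter> U"

definition half :: "'a set \<Rightarrow> 'a set" where
  "half U = stems U - U"

text \<open>
  A dominated vertex next to a live \<open>t\<close> is worth one more: if it becomes a pendant neighbor of \<open>t\<close> while
  the leaf at \<open>t\<close> is isolated, the two components weigh only 27 and need two moves.
\<close>

definition charged :: "'a set \<Rightarrow> 'a set" where
  "charged U = {r. r \<notin> U \<and> r \<notin> stems U \<and> N r \<inter> live U \<noteq> {}}"

definition pot :: "'a set \<Rightarrow> int" where
  "pot U = 5 * int (card (movers U)) + 6 * int (card U)
    + 3 * int (card (half U)) + int (card (charged U))"

section \<open>Leaves, stems and finiteness\<close>

lemma leaf_N: "u \<in> leaves t \<Longrightarrow> N u = {t}"
  by (simp add: leaves_def)

lemma leaf_in_N: "u \<in> leaves t \<Longrightarrow> u \<in> N t"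
  using N_sym by (auto simp: leaves_def)

lemma stem_other_nbr: "u \<in> leaves t \<Longrightarrow> \<exists>r \<in> N t. r \<noteq> u"
  using N_not_edge[of u t] leaf_in_N[of u t] by (auto simp: leaves_def)

lemma stem_not_leaf: "u \<in> leaves t \<Longrightarrow> t \<notin> leaves s"
  using stem_other_nbr[of u t] leaf_in_N[of u t] by (auto simp: leaves_def)

lemma in_V: "u \<in> N v \<Longrightarrow> u \<in> V" "u \<in> N v \<Longrightarrow> v \<in> V"
  using N_subset N_sym by blast+

lemma mover_in_V: "N w \<inter> U \<noteq> {} \<Longrightarrow> w \<in> V"
  using in_V(2) by blast

lemma movers_sub: "movers U \<subseteq> V"
  unfolding movers_def using mover_in_V by auto

lemma stems_sub: "stems U \<subseteq> V"
  unfolding stems_def leaves_def using N_subset by blast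

lemma finite_sets [simp]: "finite (movers U)" "finite (stems U)" "finite (live U)"
    "finite (half U)" "finite (charged U)" "finite (N v)"
proof -
  show "finite (movers U)" by (rule finite_subset[OF movers_sub finite_V])
  show st: "finite (stems U)" by (rule finite_subset[OF stems_sub finite_V])
  show "finite (live U)" "finite (half U)" using st by (auto simp: live_def half_def)
  have "charged U \<subseteq> V" unfolding charged_def using mover_in_V by auto
  then show "finite (charged U)" using finite_V by (rule finite_subset)
  show "finite (N v)" using N_subset finite_V by (rule finite_subset)
qed

lemma N_meets: "U \<noteq> {} \<Longrightarrow> U \<subseteq> V \<Longrightarrow> \<exists>w. N w \<inter> U \<noteq> {}"
  using N_nonempty N_sym by blast

section \<open>Changes of the vertex classes under a move\<close>

lemma sets_mono:
  assumes "U' \<subseteq> U"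
  shows "movers U' \<subseteq> movers U" "stems U' \<subseteq> stems U" "live U' \<subseteq> live U"
  using assms by (auto simp: movers_def stems_def live_def)

lemma mover_not_stem: "w \<notin> stems (U - N w)"
  unfolding stems_def using leaf_in_N by auto

text \<open>Only its stem dominates a leaf, so an undominated leaf at \<open>r\<close> survives
  every move other than \<open>r\<close>.\<close>

lemma stem_stays: "r \<in> stems U \<Longrightarrow> r \<noteq> w \<Longrightarrow> r \<in> stems (U - N w)"
proof -
  assume "r \<in> stems U" "r \<noteq> w"
  then obtain u where u: "u \<in> leaves r" "u \<in> U" by (auto simp: stems_def)
  moreover have "u \<notin> N w" using leaf_N[OF u(1)] N_sym[of u w] \<open>r \<noteq> w\<close> by auto
  ultimately show ?thesis by (auto simp: stems_def)
qed

text \<open>Stems never arise anew, so a new half vertex was live and has just been dominated. The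
  played \<open>w\<close> drops out because it dominates all its leaves.\<close>

lemma half_after:
  "half (U - N w) \<subseteq> (half U - {w}) \<union> (N w \<inter> live U)"
  using mover_not_stem[of w U] sets_mono(2)[of "U - N w" U]
  by (auto simp: half_def live_def)

text \<open>Only \<open>w\<close> can cease to be a stem, and its neighbors are all dominated now.
  Hence a newly charged vertex was never a stem and has just been dominated.\<close>

lemma charged_after:
  "charged (U - N w) \<subseteq> (charged U - {w})
     \<union> {z \<in> N w \<inter> U - live U. N z \<inter> live (U - N w) \<noteq> {}}"
proof
  fix r assume r: "r \<in> charged (U - N w)"
  then have a: "r \<notin> U - N w" "r \<notin> stems (U - N w)" "N r \<inter> live (U - N w) \<noteq> {}"
    by (auto simp: charged_def)
  have rw: "r \<noteq> w" using a(3) by (auto simp: live_def)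
  have s: "r \<notin> stems U" using a(2) stem_stays rw by blast
  have l: "N r \<inter> live U \<noteq> {}" using a(3) sets_mono(3)[of "U - N w" U] by blast
  show "r \<in> (charged U - {w}) \<union> {z \<in> N w \<inter> U - live U. N z \<inter> live (U - N w) \<noteq> {}}"
    using a s l rw by (auto simp: charged_def live_def)
qed

section \<open>Drop of the potential under one move\<close>

lemma movers_after:
  assumes "N w \<inter> U \<noteq> {}" "S \<subseteq> movers U" "\<And>r. r \<in> S \<Longrightarrow> N r \<inter> U \<subseteq> N w"
  shows "card (movers (U - N w)) + card S \<le> card (movers U)"
proof -
  have "movers (U - N w) \<inter> S = {}" using assms(3) by (auto simp: movers_def)
  moreover have "movers (U - N w) \<subseteq> movers U" by (rule sets_mono) auto
  moreover have "finite S" using assms(2) finite_sets(1) by (rule finite_subset)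
  ultimately have "card (movers (U - N w) \<union> S) = card (movers (U - N w)) + card S"
    by (intro card_Un_disjoint) auto
  moreover have "card (movers (U - N w) \<union> S) \<le> card (movers U)"
    using assms(2) \<open>movers (U - N w) \<subseteq> movers U\<close> by (intro card_mono) auto
  ultimately show ?thesis by simp
qed

lemma card_after:
  assumes "finite U"
  shows "card (U - N w) + card (N w \<inter> U) = card U"
  using card_Diff_subset_Int[of U "N w"] assms card_mono[of U "U \<inter> N w"]
  by (auto simp: Int_commute)

text \<open>Net release for dominating \<open>z\<close>. The basis is 6. A live \<open>z\<close>
  adds 5, because a leaf at it ceases to be playable, and costs 3 for becoming half. Any other
  \<open>z\<close> costs 1 if it becomes charged.\<close>

definition val :: "'a \<Rightarrow> 'a set \<Rightarrow> 'a \<Rightarrow> int" where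
  "val w U z = (if z \<in> live U then 8 else if N z \<inter> live (U - N w) = {} then 6 else 5)"

text \<open>The leading 5 is \<open>w\<close>, which is no longer playable; the bonuses 3 and 1 come
  from \<open>w\<close> leaving \<open>half\<close> and \<open>charged\<close>. A leaf
  \<open>w\<close> at a live vertex is excluded because it could be the very leaf whose 5 is already
  counted in \<open>val\<close>.\<close>

lemma pot_gain:
  assumes U: "U \<subseteq> V" and K: "N w \<inter> U \<noteq> {}" and nl: "\<And>t. t \<in> live U \<Longrightarrow> w \<notin> leaves t"
  shows "pot (U - N w) + 5 + (\<Sum>z \<in> N w \<inter> U. val w U z)
    + (if w \<in> half U then 3 else 0) + (if w \<in> charged U then 1 else 0) \<le> pot U"
proof -
  let ?K = "N w \<inter> U" and ?U = "U - N w"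
  let ?L = "N w \<inter> live U"
  let ?C = "{z \<in> N w \<inter> U - live U. N z \<inter> live (U - N w) \<noteq> {}}"
  have fU: "finite U" using U finite_V by (rule finite_subset)
  \<comment> \<open>\<open>f\<close> picks one undominated leaf per live vertex. Distinct stems have
    distinct leaves, so the lost movers do not overlap.\<close>
  define f where "f t = (SOME u. u \<in> leaves t \<inter> U)" for t
  have f: "f t \<in> leaves t" "f t \<in> U" if "t \<in> live U" for t
  proof -
    have "\<exists>u. u \<in> leaves t \<inter> U" using that by (auto simp: live_def stems_def)
    from someI_ex[OF this] show "f t \<in> leaves t" "f t \<in> U" by (auto simp: f_def)
  qed
  have Nf: "N (f t) = {t}" if "t \<in> live U" for t using leaf_N[OF f(1)[OF that]] .
  have inj: "inj_on f ?L"
  proof (rule inj_onI)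
    fix x y assume "x \<in> ?L" "y \<in> ?L" "f x = f y"
    then show "x = y" using Nf[of x] Nf[of y] by (metis IntD2 singleton_inject)
  qed
  have w: "w \<notin> f ` ?L" using f nl by blast
  let ?S = "insert w (f ` ?L)"
  have "card (movers ?U) + card ?S \<le> card (movers U)"
  proof (rule movers_after[OF K])
    have "N (f t) \<inter> U \<noteq> {}" if "t \<in> live U" for t
      using that by (simp add: Nf) (simp add: live_def)
    then show "?S \<subseteq> movers U" using K unfolding movers_def by blast
    show "N r \<inter> U \<subseteq> N w" if r: "r \<in> ?S" for r
    proof (cases "r = w")
      case False
      then obtain t where "t \<in> ?L" "r = f t" using r by blast
      then have "N r = {t}" using Nf[of t] by simp
      moreover have "t \<in> N w" using \<open>t \<in> ?L\<close> by blast
      ultimately show ?thesis by (metis Int_lower1 insert_subset order_trans empty_subsetI)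
    qed blast
  qed
  moreover have "card ?S = Suc (card ?L)" using w inj by (simp add: card_image)
  ultimately have m: "card (movers ?U) + Suc (card ?L) \<le> card (movers U)" by simp
  have h: "card (half ?U) + (if w \<in> half U then 1 else 0) \<le> card (half U) + card ?L"
  proof -
    have "card (half ?U) \<le> card (half U - {w}) + card ?L"
      by (rule order_trans[OF card_mono[OF _ half_after] card_Un_le]) simp
    moreover have "card (half U) = Suc (card (half U - {w}))" if "w \<in> half U"
      using that card.remove[of "half U" w] by simp
    ultimately show ?thesis by auto
  qed
  have c: "card (charged ?U) + (if w \<in> charged U then 1 else 0) \<le> card (charged U) + card ?C"
  proof -
    have "card (charged ?U) \<le> card (charged U - {w}) + card ?C"
      by (rule order_trans[OF card_mono[OF _ charged_after] card_Un_le]) (simp add: fU)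
    moreover have "card (charged U) = Suc (card (charged U - {w}))" if "w \<in> charged U"
      using that card.remove[of "charged U" w] by simp
    ultimately show ?thesis by auto
  qed
  have KL2: "?K \<inter> live U = ?L" by (auto simp: live_def)
  have "val w U z = 6 + (if z \<in> live U then 2 else 0) - (if z \<in> ?C then 1 else 0)"
    if "z \<in> ?K" for z
    using that unfolding val_def by simp
  then have "(\<Sum>z \<in> ?K. val w U z) = (\<Sum>z \<in> ?K. 6 + (if z \<in> live U then 2 else 0)
      - (if z \<in> ?C then 1 else (0::int)))"
    by (intro sum.cong refl)
  also have "\<dots> = 6 * int (card ?K) + 2 * int (card ?L) - int (card ?C)"
  proof -
    have "(\<Sum>z \<in> ?K. (if z \<in> live U then 2 else (0::int))) = 2 * int (card ?L)"
      using sum.inter_restrict[of ?K "\<lambda>_. 2::int" "live U"] KL2 by simp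
    moreover have "(\<Sum>z \<in> ?K. (if z \<in> ?C then 1 else (0::int))) = int (card ?C)"
    proof -
      have "?K \<inter> ?C = ?C" by blast
      then show ?thesis using sum.inter_restrict[of ?K "\<lambda>_. 1::int" ?C] by simp
    qed
    ultimately show ?thesis by (simp only: sum_subtractf sum.distrib) simp
  qed
  finally have v: "(\<Sum>z \<in> ?K. val w U z) = 6 * int (card ?K) + 2 * int (card ?L) - int (card ?C)" .
  have u: "card ?U + card ?K = card U" by (rule card_after[OF fU])
  have e: "int (if w \<in> X then 1 else 0) = (if w \<in> X then 1 else 0)" for X by simp
  have "3 * int (if w \<in> half U then 1 else 0) = (if w \<in> half U then 3 else 0)" by simp
  then show ?thesis using m h c v u e[of "charged U"] unfolding pot_def by linarith
qed

text \<open>The release is 5 for \<open>w\<close> and 6 for \<open>t\<close>, less 3 because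
  \<open>t\<close> may become half. The only new dominated vertex is the live \<open>t\<close>, so
  nothing becomes charged and each lost charge is pure gain.\<close>

lemma pot_gain_leaf:
  assumes U: "U \<subseteq> V" and t: "t \<in> live U" and w: "w \<in> leaves t"
  shows "pot (U - N w) + 8 + int (card (charged U - charged (U - N w))) \<le> pot U"
proof -
  have N: "N w = {t}" using leaf_N[OF w] .
  have tU: "t \<in> U" using t by (auto simp: live_def)
  have fU: "finite U" using U finite_V by (rule finite_subset)
  have "card (movers (U - N w)) + card {w} \<le> card (movers U)"
    by (rule movers_after) (use N tU in \<open>auto simp: movers_def\<close>)
  moreover have "card (U - N w) + 1 = card U" using card_after[OF fU, of w] N tU by simp
  moreover have "card (half (U - N w)) \<le> card (half U) + 1"
  proof -
    have "half (U - N w) \<subseteq> insert t (half U)" using half_after[of U w] N by auto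
    from card_mono[OF _ this] show ?thesis by (auto simp: card_insert_if split: if_splits)
  qed
  moreover have "card (charged (U - N w)) + card (charged U - charged (U - N w)) = card (charged U)"
  proof -
    have "charged (U - N w) \<subseteq> charged U" using charged_after[of U w] N t by auto
    then show ?thesis by (simp add: card_Diff_subset card_mono)
  qed
  ultimately show ?thesis unfolding pot_def by simp
qed

lemma val_ge: "5 \<le> val w U z"
  by (simp add: val_def)

lemma val_live: "z \<in> live U \<Longrightarrow> val w U z = 8"
  by (simp add: val_def)

lemma val_uncharged: "N z \<inter> live (U - N w) = {} \<Longrightarrow> 6 \<le> val w U z"
  by (simp add: val_def)

text \<open>The only neighbor of \<open>u\<close> is the played \<open>t\<close>, which is no longer
  a stem, so \<open>u\<close> does not become charged.\<close>

lemma val_leaf: "u \<in> leaves t \<Longrightarrow> 6 \<le> val t U u"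
  using mover_not_stem[of t U] leaf_N[of u t] by (intro val_uncharged) (auto simp: live_def)

lemma gain1:
  assumes "U \<subseteq> V" "a \<in> N w \<inter> U" "\<And>t. t \<in> live U \<Longrightarrow> w \<notin> leaves t"
  shows "pot (U - N w) + 5 + val w U a \<le> pot U"
proof -
  have "val w U a \<le> (\<Sum>z \<in> N w \<inter> U. val w U z)"
    using assms(2) order_trans[OF _ val_ge] by (intro member_le_sum) auto
  moreover have "N w \<inter> U \<noteq> {}" using assms(2) by blast
  ultimately show ?thesis using pot_gain[OF assms(1) _ assms(3)] by (simp split: if_splits)
qed

lemma gain2:
  assumes "U \<subseteq> V" "a \<in> N w \<inter> U" "b \<in> N w \<inter> U" "a \<noteq> b"
  shows "pot (U - N w) + 5 + val w U a + val w U b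
    + (if w \<in> half U then 3 else 0) + (if w \<in> charged U then 1 else 0) \<le> pot U"
proof -
  have "(\<Sum>z \<in> {a, b}. val w U z) \<le> (\<Sum>z \<in> N w \<inter> U. val w U z)"
    using assms(2,3) order_trans[OF _ val_ge] by (intro sum_mono2) auto
  moreover have "w \<notin> leaves t" for t using assms(2-4) by (auto simp: leaves_def)
  moreover have "N w \<inter> U \<noteq> {}" using assms(2) by blast
  ultimately show ?thesis using pot_gain[of U w] assms(1,4) by simp
qed

lemma stem_leafE:
  assumes "t \<in> stems U"
  obtains u where "u \<in> leaves t" "u \<in> N t \<inter> U" "\<And>U'. u \<notin> live U'" "\<And>U'. u \<notin> stems U'"
proof -
  obtain u where u: "u \<in> leaves t" "u \<in> U" using assms by (auto simp: stems_def)
  have "u \<notin> stems U'" for U' using stem_not_leaf u(1) by (auto simp: stems_def)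
  then show ?thesis using that[of u] u leaf_in_N by (auto simp: live_def)
qed

section \<open>Positions with few live vertices\<close>

text \<open>\<open>live_sparse\<close> and \<open>half_apart\<close> hold whenever no move releases
  20 (\<open>live_sparse_if_no_20\<close>). The first survives every move; the second has to be
  re-established.\<close>

definition live_sparse :: "'a set \<Rightarrow> bool" where
  "live_sparse U \<longleftrightarrow> (\<forall>x s t. s \<in> N x \<inter> live U \<longrightarrow> t \<in> N x \<inter> live U \<longrightarrow> s = t)"

definition half_apart :: "'a set \<Rightarrow> bool" where
  "half_apart U \<longleftrightarrow> (\<forall>w \<in> half U. N w \<inter> live U = {})"

lemma live_sparse_mono: "live_sparse U \<Longrightarrow> U' \<subseteq> U \<Longrightarrow> live_sparse U'"
  using sets_mono(3)[of U' U] unfolding live_sparse_def by blast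

lemma live_sparseD: "live_sparse U \<Longrightarrow> s \<in> N x \<Longrightarrow> s \<in> live U \<Longrightarrow> t \<in> N x \<Longrightarrow> t \<in> live U \<Longrightarrow> s = t"
  unfolding live_sparse_def by blast

text \<open>A violating half vertex cannot have been half before, so it was live and has become
  dominated since. The third hypothesis rules out exactly this.\<close>

lemma half_apartI_after:
  assumes "half_apart U" "U' \<subseteq> U"
    and "\<And>w s. w \<in> live U \<Longrightarrow> w \<notin> U' \<Longrightarrow> w \<in> stems U' \<Longrightarrow> s \<in> N w \<Longrightarrow> s \<in> live U' \<Longrightarrow> False"
  shows "half_apart U'"
  unfolding half_apart_def
proof (intro ballI equals0I)
  fix w s assume w: "w \<in> half U'" and s: "s \<in> N w \<inter> live U'"
  have st: "w \<in> stems U" "s \<in> live U" using w s sets_mono[OF assms(2)] by (auto simp: half_def)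
  have "w \<in> U" using assms(1) st s unfolding half_apart_def half_def by blast
  then show False using assms(3)[of w s] w s st by (auto simp: half_def live_def)
qed

lemma gain_staller:
  assumes "U \<subseteq> V" "N w \<inter> U \<noteq> {}"
  shows "pot (U - N w) + 8 \<le> pot U"
    and "(\<And>t. t \<in> live U \<Longrightarrow> w \<notin> leaves t) \<Longrightarrow> pot (U - N w) + 10 \<le> pot U"
proof -
  obtain a where a: "a \<in> N w \<inter> U" using assms(2) by blast
  show *: "pot (U - N w) + 10 \<le> pot U" if "\<And>t. t \<in> live U \<Longrightarrow> w \<notin> leaves t"
    using gain1[OF assms(1) a that] val_ge[of w U a] by simp
  show "pot (U - N w) + 8 \<le> pot U"
  proof (cases "\<exists>t \<in> live U. w \<in> leaves t")
    case True
    then show ?thesis using pot_gain_leaf[OF assms(1)] by fastforce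
  next
    case False
    then have "pot (U - N w) + 10 \<le> pot U" by (intro *) blast
    then show ?thesis by simp
  qed
qed

lemma pot_nonneg: "0 \<le> pot U"
  by (simp add: pot_def)

lemma removal_psubset: "N w \<inter> U \<noteq> {} \<Longrightarrow> U - N w \<subset> U"
  by blast

lemma dominator_via:
  assumes "N w \<inter> U \<noteq> {}" "affords Staller c (U - N w)" "c + 14 \<le> d"
  shows "affords Dominator d U"
  using assms(1) by (rule dominator) (use assms(2,3) affords_mono in auto)

text \<open>A credit of 6 completes the guaranteed 8 to the cost 14. Dominator earns it with a move
  that releases 20; likewise 19 and 18 earn the credits 5 and 4 used below.\<close>

lemma staller_any:
  assumes U: "U \<subseteq> V" and IH: "\<And>U'. U' \<subset> U \<Longrightarrow> affords Dominator (pot U') U'"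
  shows "affords Staller (pot U + 6) U"
proof (cases "U = {}")
  case True
  then show ?thesis using pot_nonneg[of U] by (auto intro: finished)
next
  case False
  then show ?thesis
  proof (rule staller)
    fix w assume w: "N w \<inter> U \<noteq> {}"
    show "affords Dominator (pot U + 6 - 14) (U - N w)"
      using affords_mono[OF IH[OF removal_psubset[OF w]]] gain_staller(1)[OF U w] by simp
  qed
qed

text \<open>The reply \<open>t\<close> is half after \<open>x\<close>, so it releases 5 + 3 and 6
  each for a leaf and a second neighbor \<open>d\<close>. The only live neighbor that
  \<open>d\<close> could have was \<open>t\<close>, hence \<open>d\<close> is not charged. With the
  8 for \<open>x\<close> this pays for two moves.\<close>

lemma gain_leaf_reply:
  assumes U: "U \<subseteq> V" and p: "live_sparse U" and t: "t \<in> live U" and x: "x \<in> leaves t"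
    and bc: "b \<in> N t \<inter> U" "c \<in> N t \<inter> U" "b \<noteq> c"
  shows "pot (U - N x - N t) + 28 \<le> pot U"
proof -
  let ?U = "U - N x"
  have Nx: "N x = {t}" using leaf_N[OF x] .
  have tx: "t \<noteq> x" using leaf_in_N[OF x] N_irrefl by blast
  have tU: "t \<in> U" "t \<in> stems U" using t by (auto simp: live_def)
  obtain u where u: "u \<in> leaves t" "u \<in> N t \<inter> U" using stem_leafE[OF tU(2)] by metis
  obtain d where d: "d \<in> N t \<inter> U" "d \<noteq> u" using bc by metis
  have nt: "t \<notin> N t" by (rule N_irrefl)
  have in': "u \<in> N t \<inter> ?U" "d \<in> N t \<inter> ?U" using u d Nx nt by auto
  have th: "t \<in> half ?U" using stem_stays[OF tU(2) tx] Nx by (auto simp: half_def)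
  have "6 \<le> val t ?U d"
  proof (rule val_uncharged, rule equals0I)
    fix s assume s: "s \<in> N d \<inter> live (?U - N t)"
    have "s \<in> live U" using s sets_mono(3)[of "?U - N t" U] by blast
    moreover have "t \<in> N d" using d N_sym by blast
    ultimately have "s = t" using live_sparseD[OF p, of s d t] s t by blast
    then show False using s Nx by (auto simp: live_def)
  qed
  moreover have "6 \<le> val t ?U u" by (rule val_leaf[OF u(1)])
  moreover have "?U \<subseteq> V" using U by blast
  ultimately have "pot (?U - N t) + 20 \<le> pot ?U"
    using gain2[OF _ in'] d th by (auto split: if_splits)
  moreover have "pot ?U + 8 \<le> pot U" using pot_gain_leaf[OF U t x] by simp
  ultimately show ?thesis by simp
qed

text \<open>Besides its leaf, \<open>t\<close> has a dominated neighbor \<open>r\<close>. By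
  \<open>half_apart\<close> it is no stem, so it is charged, and it loses the charge with its only
  live neighbor \<open>t\<close>: 8 + 1.\<close>

lemma gain_leaf_forced:
  assumes U: "U \<subseteq> V" and p: "live_sparse U" and h: "half_apart U" and t: "t \<in> live U" and x: "x \<in> leaves t"
    and one: "\<And>b c. b \<in> N t \<inter> U \<Longrightarrow> c \<in> N t \<inter> U \<Longrightarrow> b = c"
  shows "pot (U - N x) + 9 \<le> pot U"
proof -
  have tU: "t \<in> U" "t \<in> stems U" using t by (auto simp: live_def)
  obtain u where u: "u \<in> leaves t" "u \<in> N t \<inter> U" using stem_leafE[OF tU(2)] by metis
  obtain r where r: "r \<in> N t" "r \<noteq> u" using stem_other_nbr[OF u(1)] by blast
  have rU: "r \<notin> U" using one[of r u] r u by blast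
  have tr: "t \<in> N r" using r N_sym by blast
  have "r \<notin> stems U" using h rU tr t unfolding half_apart_def half_def by blast
  then have "r \<in> charged U" using rU tr t by (auto simp: charged_def)
  moreover have "r \<notin> charged (U - N x)"
  proof
    assume "r \<in> charged (U - N x)"
    then obtain s where s: "s \<in> N r" "s \<in> live (U - N x)" by (auto simp: charged_def)
    then have "s = t" using live_sparseD[OF p, of s r t] sets_mono(3)[of "U - N x" U] tr t by blast
    then show False using s leaf_N[OF x] by (auto simp: live_def)
  qed
  ultimately have "charged U - charged (U - N x) \<noteq> {}" by blast
  then have "1 \<le> card (charged U - charged (U - N x))"
    by (simp add: Suc_le_eq card_gt_0_iff)
  then show ?thesis using pot_gain_leaf[OF U t x] by simp
qed

text \<open>A live vertex that is dominated by these two moves but still a stem is a neighbor of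
  \<open>t\<close>; by sparsity \<open>t\<close> was its only live neighbor.\<close>

lemma half_apart_reply:
  assumes p: "live_sparse U" and h: "half_apart U" and t: "t \<in> live U" and x: "x \<in> leaves t"
  shows "half_apart (U - N x - N t)"
proof (rule half_apartI_after[OF h])
  fix w s assume w: "w \<in> live U" "w \<notin> U - N x - N t" "w \<in> stems (U - N x - N t)"
    and s: "s \<in> N w" "s \<in> live (U - N x - N t)"
  have "w \<noteq> t" using w(3) mover_not_stem[of t "U - N x"] by blast
  then have "w \<in> N t" using w(1,2) leaf_N[OF x] by (auto simp: live_def)
  then have "t \<in> N w" by (rule N_sym)
  moreover have "s \<in> live U" using s(2) sets_mono(3)[of "U - N x - N t" U] by blast
  ultimately have "s = t" using live_sparseD[OF p, of s w t] s t by blast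
  then show False using s leaf_N[OF x] by (auto simp: live_def)
qed blast

text \<open>The credit 5 covers every move that releases at least 9. The remaining leaf moves are
  answered by \<open>t\<close>: the pair pays for itself and preserves both conditions, so the
  credit is carried along the induction.\<close>

lemma staller_sparse:
  assumes "U \<subseteq> V" "\<And>U'. U' \<subset> U \<Longrightarrow> affords Dominator (pot U') U'" "live_sparse U" "half_apart U"
  shows "affords Staller (pot U + 5) U"
  using finite_subset[OF assms(1) finite_V] assms
proof (induction U rule: finite_psubset_induct)
  case (psubset U)
  note U = psubset.prems(1) and IH = psubset.prems(2) and p = psubset.prems(3) and h = psubset.prems(4)
  show ?case
  proof (cases "U = {}")
    case True
    then show ?thesis using pot_nonneg[of U] by (auto intro: finished)
  next
    case False
    then show ?thesis
    proof (rule staller)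
      fix x assume x: "N x \<inter> U \<noteq> {}"
      have IHx: "affords Dominator (pot (U - N x)) (U - N x)" by (rule IH[OF removal_psubset[OF x]])
      show "affords Dominator (pot U + 5 - 14) (U - N x)"
      proof (cases "\<exists>t \<in> live U. x \<in> leaves t")
        case False
        then have "pot (U - N x) + 10 \<le> pot U" by (intro gain_staller(2)[OF U x]) blast
        then show ?thesis by (intro affords_mono[OF IHx]) simp
      next
        case True
        then obtain t where t: "t \<in> live U" "x \<in> leaves t" by blast
        show ?thesis
        proof (cases "\<exists>b c. b \<in> N t \<inter> U \<and> c \<in> N t \<inter> U \<and> b \<noteq> c")
          case True
          then obtain b c where bc: "b \<in> N t \<inter> U" "c \<in> N t \<inter> U" "b \<noteq> c" by blast
          let ?U = "U - N x - N t"
          have sub: "?U \<subset> U" using x by blast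
          have "affords Staller (pot ?U + 5) ?U"
          proof (rule psubset.IH[OF sub])
            show "?U \<subseteq> V" using U by blast
            show "live_sparse ?U" by (rule live_sparse_mono[OF p]) blast
            show "half_apart ?U" by (rule half_apart_reply[OF p h t])
            show "affords Dominator (pot U') U'" if "U' \<subset> ?U" for U'
              using that sub by (intro IH) blast
          qed
          moreover have "N t \<inter> (U - N x) \<noteq> {}"
            using bc N_irrefl[of t] leaf_N[OF t(2)] by auto
          moreover have "pot ?U + 5 + 14 \<le> pot U + 5 - 14"
            using gain_leaf_reply[OF U p t bc] by simp
          ultimately show ?thesis by (metis dominator_via)
        next
          case False
          then have "pot (U - N x) + 9 \<le> pot U" by (intro gain_leaf_forced[OF U p h t]) blast
          then show ?thesis by (intro affords_mono[OF IHx]) simp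
        qed
      qed
    qed
  qed
qed

text \<open>
  The half-dominated \<open>t\<close> is a reserve move worth 20 that no cheap move of Staller destroys.
\<close>

lemma staller_half_reply:
  assumes "U \<subseteq> V" "\<And>U'. U' \<subset> U \<Longrightarrow> affords Dominator (pot U') U'" "live_sparse U" "half_apart U"
    "t \<in> half U" "w \<in> N t" "w \<in> U" "w \<notin> leaves t" "w \<notin> live U" "N w \<inter> live U = {}"
  shows "affords Staller (pot U + 4) U"
  using finite_subset[OF assms(1) finite_V] assms
proof (induction U rule: finite_psubset_induct)
  case (psubset U)
  note U = psubset.prems(1) and IH = psubset.prems(2) and p = psubset.prems(3) and h = psubset.prems(4)
    and th = psubset.prems(5) and w = psubset.prems(6-10)
  have ts: "t \<in> stems U" "t \<notin> U" using th by (auto simp: half_def)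
  have "U \<noteq> {}" using w by blast
  then show ?case
  proof (rule staller)
    fix x assume x: "N x \<inter> U \<noteq> {}"
    have IHx: "affords Dominator (pot (U - N x)) (U - N x)" by (rule IH[OF removal_psubset[OF x]])
    show "affords Dominator (pot U + 4 - 14) (U - N x)"
    proof (cases "\<exists>t \<in> live U. x \<in> leaves t")
      case False
      then have "pot (U - N x) + 10 \<le> pot U" by (intro gain_staller(2)[OF U x]) blast
      then show ?thesis by (intro affords_mono[OF IHx]) simp
    next
      case True
      then obtain s where s: "s \<in> live U" "x \<in> leaves s" by blast
      have Nx: "N x = {s}" using leaf_N[OF s(2)] .
      have sU: "s \<in> U" using s by (auto simp: live_def)
      have tsx: "t \<noteq> x" using ts(1) stem_not_leaf[of _ t s] s(2) by (auto simp: stems_def)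
      have tss: "t \<noteq> s" using sU ts by blast
      have ws: "w \<noteq> s" using w s by blast
      have wNs: "w \<notin> N s" using w(5) s(1) N_sym[of w s] by blast
      show ?thesis
      proof (cases "\<exists>b c. b \<in> N s \<inter> U \<and> c \<in> N s \<inter> U \<and> b \<noteq> c")
        case True
        then obtain b c where bc: "b \<in> N s \<inter> U" "c \<in> N s \<inter> U" "b \<noteq> c" by blast
        \<comment> \<open>This pair of moves pays for itself and keeps the reserve: \<open>t\<close>
          retains an undominated leaf, and \<open>w\<close> is neither \<open>s\<close> nor adjacent
          to \<open>s\<close>.\<close>
        let ?U = "U - N x - N s"
        have sub: "?U \<subset> U" using x by blast
        have lsub: "live ?U \<subseteq> live U" using sub by (intro sets_mono) blast
        have "affords Staller (pot ?U + 4) ?U"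
        proof (rule psubset.IH[OF sub])
          show "?U \<subseteq> V" using U by blast
          show "live_sparse ?U" by (rule live_sparse_mono[OF p]) blast
          show "half_apart ?U" by (rule half_apart_reply[OF p h s])
          show "affords Dominator (pot U') U'" if "U' \<subset> ?U" for U'
            using that sub by (intro IH) blast
          show "t \<in> half ?U"
            using stem_stays[OF stem_stays[OF ts(1) tsx] tss] ts(2) by (auto simp: half_def)
          show "w \<in> ?U" using w ws wNs Nx by blast
          show "w \<notin> live ?U" "N w \<inter> live ?U = {}" using w lsub by blast+
        qed (use w in auto)
        moreover have "N s \<inter> (U - N x) \<noteq> {}" using bc N_irrefl[of s] Nx by auto
        moreover have "pot ?U + 4 + 14 \<le> pot U + 4 - 14"
          using gain_leaf_reply[OF U p s bc] by simp
        ultimately show ?thesis by (metis dominator_via)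
      next
        case False
        then have one: "b = c" if "b \<in> N s \<inter> U" "c \<in> N s \<inter> U" for b c using that by blast
        have g9: "pot (U - N x) + 9 \<le> pot U" by (intro gain_leaf_forced[OF U p h s] one)
        \<comment> \<open>The reserve is spent here: 9 + 20 pays for both moves and raises the
          credit from 4 to 5.\<close>
        let ?U = "U - N x - N t"
        have sub: "?U \<subset> U" using x by blast
        have th': "t \<in> half (U - N x)" using stem_stays[OF ts(1) tsx] ts(2) by (auto simp: half_def)
        have "t \<in> stems (U - N x)" using th' by (simp add: half_def)
        then obtain u where u: "u \<in> leaves t" "u \<in> N t \<inter> (U - N x)" using stem_leafE by metis
        have wx: "w \<in> N t \<inter> (U - N x)" using w ws Nx by blast
        have "6 \<le> val t (U - N x) u" by (rule val_leaf[OF u(1)])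
        moreover have "6 \<le> val t (U - N x) w"
          using w sets_mono(3)[of "U - N x - N t" U] by (intro val_uncharged) blast
        moreover have "U - N x \<subseteq> V" "u \<noteq> w" using U u w by auto
        ultimately have g20: "pot ?U + 20 \<le> pot (U - N x)"
          using gain2[OF _ u(2) wx] th' by (auto split: if_splits)
        have "affords Staller (pot ?U + 5) ?U"
        proof (rule staller_sparse)
          show "?U \<subseteq> V" using U by blast
          show "live_sparse ?U" by (rule live_sparse_mono[OF p]) blast
          show "affords Dominator (pot U') U'" if "U' \<subset> ?U" for U'
            using that sub by (intro IH) blast
          show "half_apart ?U"
          proof (rule half_apartI_after[OF h])
            fix w' s' assume w': "w' \<in> live U" "w' \<notin> ?U" "w' \<in> stems ?U"
              and s': "s' \<in> N w'" "s' \<in> live ?U"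
            show False
            proof (cases "w' = s")
              case True
              \<comment> \<open>The single undominated neighbor of \<open>s\<close> is a leaf, and
                leaves are never live.\<close>
              obtain y where y: "y \<in> N s \<inter> U" "y \<notin> live U"
                using stem_leafE[of s U] s by (metis IntD1 live_def)
              have "s' \<in> live U" using s' sets_mono(3)[of ?U U] by blast
              then show False using one[of s' y] y s' True by (auto simp: live_def)
            next
              case False
              then have "w' \<in> N t" using w' Nx by (auto simp: live_def)
              then show False using h th w' unfolding half_apart_def by blast
            qed
          qed blast
        qed
        moreover have "N t \<inter> (U - N x) \<noteq> {}" using u by blast
        moreover have "pot ?U + 5 + 14 \<le> pot U + 4 - 14" using g9 g20 by simp
        ultimately show ?thesis by (metis dominator_via)
      qed
    qed
  qed
qed

section \<open>The final phase\<close>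

text \<open>
  The set \<open>T\<close> consists of the vertices that are live when the phase begins. A star of weight at least
  16 at such a vertex passes 2 on to its leaf.
\<close>

definition tight :: "'a set \<Rightarrow> 'a set" where
  "tight U = {t \<in> stems U. card (N t \<inter> U) = 1}"

text \<open>The smallest stars weigh exactly 14: an undominated vertex of \<open>T\<close> with two
  playable neighbors has 5 + 5 + 6 - 2, and a tight stem with its isolated leaf has 5 + 6 + 2 +
  1.\<close>

definition late_pot :: "'a set \<Rightarrow> 'a set \<Rightarrow> int" where
  "late_pot T U = 5 * int (card (movers U)) + 6 * int (card U) - 2 * int (card (T \<inter> U))
    + 2 * int (card (stems U)) + int (card (tight U))"

text \<open>An undominated vertex of \<open>T\<close> is the center of an isolated star.
  Disjointness of the neighborhoods limits how many stems one move can make tight.\<close>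

definition late :: "'a set \<Rightarrow> 'a set \<Rightarrow> bool" where
  "late T U \<longleftrightarrow> U \<subseteq> V \<and> stems U - tight U \<subseteq> T \<and> (\<forall>t \<in> T. 2 \<le> card (N t))
    \<and> (\<forall>t \<in> T. \<forall>r \<in> N t. N r \<inter> U \<subseteq> {t})
    \<and> (\<forall>s \<in> T. \<forall>t \<in> T. s \<noteq> t \<longrightarrow> N s \<inter> N t = {})"

lemma finite_tight [simp]: "finite (tight U)"
  by (rule finite_subset[OF _ finite_sets(2)[of U]]) (auto simp: tight_def)

lemma stem_card_pos:
  assumes "t \<in> stems U" shows "1 \<le> card (N t \<inter> U)"
proof -
  obtain u where "u \<in> leaves t" "u \<in> U" using assms by (auto simp: stems_def)
  then have "N t \<inter> U \<noteq> {}" using leaf_in_N[of u t] by blast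
  then show ?thesis by (simp add: Suc_le_eq card_gt_0_iff)
qed

lemma late_finite: "late T U \<Longrightarrow> finite U"
  using finite_subset[of U V] finite_V by (simp add: late_def)

lemma late_mono:
  assumes "late T U" shows "late T (U - N w)"
proof -
  have "t \<in> T" if t: "t \<in> stems (U - N w)" "t \<notin> tight (U - N w)" for t
  proof -
    have "t \<in> stems U" using t(1) sets_mono(2)[of "U - N w" U] by blast
    have "1 \<le> card (N t \<inter> (U - N w))" by (rule stem_card_pos[OF t(1)])
    moreover have "card (N t \<inter> (U - N w)) \<noteq> 1" using t by (simp add: tight_def)
    moreover have "card (N t \<inter> (U - N w)) \<le> card (N t \<inter> U)" by (rule card_mono) auto
    ultimately have "t \<notin> tight U" by (simp add: tight_def)
    then show ?thesis using assms \<open>t \<in> stems U\<close> unfolding late_def by blast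
  qed
  then have "stems (U - N w) - tight (U - N w) \<subseteq> T" by blast
  moreover have "N r \<inter> (U - N w) \<subseteq> {t}" if "t \<in> T" "r \<in> N t" for r t
    using assms that unfolding late_def by blast
  ultimately show ?thesis using assms unfolding late_def by (simp add: Diff_subset_conv le_supI2)
qed

lemma tight_after:
  "tight (U - N w) \<subseteq> tight U \<union> {t \<in> stems U - tight U. N t \<inter> (N w \<inter> U) \<noteq> {}}"
proof
  fix t assume t: "t \<in> tight (U - N w)"
  have st: "t \<in> stems U" using t sets_mono(2)[of "U - N w" U] by (auto simp: tight_def)
  show "t \<in> tight U \<union> {t \<in> stems U - tight U. N t \<inter> (N w \<inter> U) \<noteq> {}}"
  proof (cases "N t \<inter> (N w \<inter> U) = {}")
    case True
    then have "N t \<inter> (U - N w) = N t \<inter> U" by blast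
    then show ?thesis using t st by (simp add: tight_def)
  next
    case False
    then show ?thesis using st by blast
  qed
qed

text \<open>Apart from the 2 paid back for each dominated vertex of \<open>T\<close>, only the
  number of tight stems can rise. A stem becomes tight only by losing a neighbor to the move, and
  \<open>m\<close> bounds these stems.\<close>

lemma late_gain:
  assumes l: "late T U" and K: "N w \<inter> U \<noteq> {}"
    and M: "S \<subseteq> movers U" "\<And>r. r \<in> S \<Longrightarrow> N r \<inter> U \<subseteq> N w"
    and new: "card {t \<in> stems (U - N w) - tight U. N t \<inter> (N w \<inter> U) \<noteq> {}} \<le> m"
  shows "late_pot T (U - N w) + 5 * int (card S) + 6 * int (card (N w \<inter> U)) - 2 * int (card (T \<inter> (N w \<inter> U)))
    + 2 * (if w \<in> stems U then 1 else 0) + (if w \<in> tight U then 1 else 0) - int m \<le> late_pot T U"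
proof -
  let ?U = "U - N w"
  let ?new = "{t \<in> stems ?U - tight U. N t \<inter> (N w \<inter> U) \<noteq> {}}"
  have fU: "finite U" using late_finite[OF l] .
  have mv: "card (movers ?U) + card S \<le> card (movers U)" by (rule movers_after[OF K M])
  have u: "card ?U + card (N w \<inter> U) = card U" by (rule card_after[OF fU])
  have T: "card (T \<inter> ?U) + card (T \<inter> (N w \<inter> U)) = card (T \<inter> U)"
  proof -
    have "T \<inter> U = (T \<inter> ?U) \<union> (T \<inter> (N w \<inter> U))" by blast
    moreover have "card ((T \<inter> ?U) \<union> (T \<inter> (N w \<inter> U))) = card (T \<inter> ?U) + card (T \<inter> (N w \<inter> U))"
      using fU by (intro card_Un_disjoint) auto
    ultimately show ?thesis by simp
  qed
  have s: "card (stems ?U) + (if w \<in> stems U then 1 else 0) \<le> card (stems U)"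
  proof -
    have "stems ?U \<subseteq> stems U - {w}" using mover_not_stem sets_mono(2)[of ?U U] by blast
    then have "card (stems ?U) \<le> card (stems U - {w})" by (intro card_mono) auto
    moreover have "card (stems U) = Suc (card (stems U - {w}))" if "w \<in> stems U"
      using that card.remove[of "stems U" w] by simp
    ultimately show ?thesis by auto
  qed
  have t: "card (tight ?U) + (if w \<in> tight U then 1 else 0) \<le> card (tight U) + m"
  proof -
    have "tight ?U \<subseteq> (tight U - {w}) \<union> ?new"
      using tight_after[of U w] mover_not_stem[of w U] unfolding tight_def by blast
    then have "card (tight ?U) \<le> card ((tight U - {w}) \<union> ?new)" by (intro card_mono) auto
    also have "\<dots> \<le> card (tight U - {w}) + m"
      using card_Un_le[of "tight U - {w}" ?new] new by linarith
    finally have "card (tight ?U) \<le> card (tight U - {w}) + m" .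
    moreover have "card (tight U) = Suc (card (tight U - {w}))" if "w \<in> tight U"
      using that card.remove[of "tight U" w] by simp
    ultimately show ?thesis by auto
  qed
  show ?thesis using mv u T s t unfolding late_pot_def by (auto split: if_splits)
qed

text \<open>The whole star disappears: at least two playable vertices and \<open>t\<close>, that is
  10 + 6 - 2.\<close>

lemma late_star:
  assumes l: "late T U" and t: "t \<in> T" "t \<in> N w \<inter> U"
  shows "N w \<inter> U = {t}" "late_pot T (U - N w) + 14 \<le> late_pot T U"
proof -
  have only: "N r \<inter> U = {t}" if "r \<in> N t" for r
    using l t that N_sym[OF that] unfolding late_def by blast
  show K: "N w \<inter> U = {t}" using only[of w] N_sym[of t w] t by blast
  have new0: "{s \<in> stems (U - N w) - tight U. N s \<inter> (N w \<inter> U) \<noteq> {}} = {}"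
  proof (rule equals0I)
    fix s assume s: "s \<in> {s \<in> stems (U - N w) - tight U. N s \<inter> (N w \<inter> U) \<noteq> {}}"
    then obtain k where k: "k \<in> N s" "k \<in> N w \<inter> U" by blast
    then have "t \<in> N s" using K by (metis singletonD)
    then have "s \<in> N t" by (rule N_sym)
    then have "N s \<inter> U = N w \<inter> U" using only[of s] K by simp
    then have "N s \<inter> (U - N w) = {}" by blast
    then show False using s stem_card_pos[of s "U - N w"] by simp
  qed
  have "late_pot T (U - N w) + 5 * int (card (N t)) + 6 * int (card (N w \<inter> U))
      - 2 * int (card (T \<inter> (N w \<inter> U)))
    + 2 * (if w \<in> stems U then 1 else 0) + (if w \<in> tight U then 1 else 0) - int 0 \<le> late_pot T U"
  proof (rule late_gain[OF l])
    show "N w \<inter> U \<noteq> {}" using K by simp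
    show "N t \<subseteq> movers U" unfolding movers_def using only by blast
    show "N r \<inter> U \<subseteq> N w" if "r \<in> N t" for r using only[OF that] K by (metis Int_lower1)
    show "card {s \<in> stems (U - N w) - tight U. N s \<inter> (N w \<inter> U) \<noteq> {}} \<le> 0"
      unfolding new0 by simp
  qed
  moreover have "2 \<le> card (N t)" using l t unfolding late_def by blast
  moreover have "T \<inter> {t} = {t}" using t by blast
  ultimately show "late_pot T (U - N w) + 14 \<le> late_pot T U" unfolding K by (auto split: if_splits)
qed

text \<open>Dominating \<open>k\<close> vertices outside \<open>T\<close> releases at least 5 + 6k
  less the number of newly tight stems. These lie in \<open>T\<close> and each uses up its own one
  of the \<open>k\<close> vertices, so 5 + 5k remains. If all stems are tight already, nothing is
  subtracted. Moves into \<open>T\<close> fall under \<open>late_star\<close>.\<close>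

lemma late_gain_staller:
  assumes l: "late T U" and K: "N w \<inter> U \<noteq> {}"
  shows "late_pot T (U - N w) + 10 \<le> late_pot T U"
    and "stems U \<subseteq> tight U \<Longrightarrow> late_pot T (U - N w) + 11 \<le> late_pot T U"
    and "stems U \<subseteq> tight U \<Longrightarrow> 2 \<le> card (N w \<inter> U) \<Longrightarrow> late_pot T (U - N w) + 17 \<le> late_pot T U"
proof -
  have fU: "finite U" using late_finite[OF l] .
  let ?K = "N w \<inter> U" and ?new = "{s \<in> stems (U - N w) - tight U. N s \<inter> (N w \<inter> U) \<noteq> {}}"
  have K1: "1 \<le> card ?K" using K by (simp add: Suc_le_eq card_gt_0_iff)
  have gain: "late_pot T (U - N w) + 5 + 6 * int (card ?K) - int m \<le> late_pot T U"
    if "T \<inter> ?K = {}" "card ?new \<le> m" for m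
    proof -
    have "{w} \<subseteq> movers U" using K by (simp add: movers_def)
    from late_gain[OF l K this _ that(2)] show ?thesis
      unfolding that(1) by (auto split: if_splits)
  qed
  have new: "card ?new \<le> card ?K"
  proof -
    have newT: "?new \<subseteq> T" using l sets_mono(2)[of "U - N w" U] unfolding late_def by blast
    define f where "f s = (SOME k. k \<in> N s \<inter> ?K)" for s
    have f: "f s \<in> N s \<inter> ?K" if "s \<in> ?new" for s
    proof -
      have "\<exists>k. k \<in> N s \<inter> ?K" using that by blast
      then show ?thesis unfolding f_def by (rule someI_ex)
    qed
    have "inj_on f ?new"
    proof (rule inj_onI, rule ccontr)
      fix x y assume xy: "x \<in> ?new" "y \<in> ?new" "f x = f y" "x \<noteq> y"
      have "f x \<in> N x \<inter> N y" using f[OF xy(1)] f[OF xy(2)] xy(3) by simp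
      moreover have "x \<in> T" "y \<in> T" using xy newT by blast+
      ultimately show False using l xy(4) unfolding late_def by blast
    qed
    moreover have "f ` ?new \<subseteq> ?K" using f by blast
    ultimately show ?thesis by (intro card_inj_on_le[of f]) (auto simp: fU)
  qed
  show "late_pot T (U - N w) + 10 \<le> late_pot T U"
  proof (cases "T \<inter> ?K = {}")
    case True
    then show ?thesis using gain[OF True new] K1 by linarith
  next
    case False
    then obtain t where "t \<in> T" "t \<in> ?K" by blast
    then show ?thesis using late_star(2)[OF l] by fastforce
  qed
  assume "stems U \<subseteq> tight U"
  then have "?new = {}" using sets_mono(2)[of "U - N w" U] by blast
  then have new0: "card ?new \<le> 0" by (simp only: card.empty)
  show "late_pot T (U - N w) + 11 \<le> late_pot T U"
  proof (cases "T \<inter> ?K = {}")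
    case True
    then show ?thesis using gain[OF True new0] K1 by linarith
  next
    case False
    then obtain t where "t \<in> T" "t \<in> ?K" by blast
    then show ?thesis using late_star(2)[OF l] by fastforce
  qed
  assume K2: "2 \<le> card ?K"
  have "T \<inter> ?K = {}"
  proof (rule equals0I)
    fix t assume "t \<in> T \<inter> ?K"
    then have "?K = {t}" using late_star(1)[OF l, of t w] by blast
    then show False using K2 by simp
  qed
  from gain[OF this new0] show "late_pot T (U - N w) + 17 \<le> late_pot T U" using K2 by linarith
qed

text \<open>The release is 5 for \<open>t\<close>, 12 for two dominated vertices and 2 for the lost
  stem. No other stem becomes tight, because neighborhoods in \<open>T\<close> are disjoint.\<close>

lemma late_gain_stem:
  assumes l: "late T U" and t: "t \<in> stems U" "t \<notin> tight U"
  shows "late_pot T (U - N t) + 19 \<le> late_pot T U"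
proof -
  let ?K = "N t \<inter> U"
  have K: "2 \<le> card ?K" using stem_card_pos[OF t(1)] t by (simp add: tight_def)
  have tT: "t \<in> T" using l t unfolding late_def by blast
  have ne: "?K \<noteq> {}" using K by auto
  have T: "T \<inter> ?K = {}"
  proof (rule equals0I)
    fix s assume "s \<in> T \<inter> ?K"
    then have "?K = {s}" using late_star(1)[OF l, of s t] by blast
    then show False using K by simp
  qed
  have "{s \<in> stems (U - N t) - tight U. N s \<inter> ?K \<noteq> {}} = {}"
  proof (rule equals0I)
    fix s assume s: "s \<in> {s \<in> stems (U - N t) - tight U. N s \<inter> ?K \<noteq> {}}"
    then have "s \<noteq> t" using mover_not_stem by blast
    moreover have "s \<in> T" using s l sets_mono(2)[of "U - N t" U] unfolding late_def by blast
    ultimately show False using s l tT unfolding late_def by blast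
  qed
  then have new0: "card {s \<in> stems (U - N t) - tight U. N s \<inter> ?K \<noteq> {}} \<le> 0"
    by (simp only: card.empty)
  have "late_pot T (U - N t) + 5 * int (card {t}) + 6 * int (card ?K) - 2 * int (card (T \<inter> ?K))
    + 2 * (if t \<in> stems U then 1 else 0) + (if t \<in> tight U then 1 else 0) - int 0 \<le> late_pot T U"
    by (rule late_gain[OF l ne _ _ new0]) (use ne in \<open>auto simp: movers_def\<close>)
  then show ?thesis using K t T by (auto split: if_splits)
qed

text \<open>The domination relation is now a union of disjoint stars, and a move removes one of
  them. Outside \<open>T\<close> a star with a single playable vertex \<open>w\<close> has a tight
  stem, giving 5 + 6 + 2 + 1; any other has at least 10 + 6.\<close>

lemma late_gain_scattered:
  assumes l: "late T U" and K: "N w \<inter> U \<noteq> {}" and one: "\<And>r. card (N r \<inter> U) \<le> 1"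
  shows "late_pot T (U - N w) + 14 \<le> late_pot T U"
proof (cases "T \<inter> (N w \<inter> U) = {}")
  case False
  then obtain t where "t \<in> T" "t \<in> N w \<inter> U" by blast
  then show ?thesis using late_star(2)[OF l] by blast
next
  case True
  have c1: "card (N w \<inter> U) = 1"
    using K one[of w] by (simp add: le_Suc_eq)
  then obtain u where u: "N w \<inter> U = {u}" by (auto simp: card_1_singleton_iff)
  have wu: "w \<in> N u" "u \<in> U" using u N_sym by blast+
  have only: "N r \<inter> U = {u}" if "r \<in> N u" for r
  proof -
    have "u \<in> N r \<inter> U" using that N_sym wu by blast
    moreover from this have "card (N r \<inter> U) \<noteq> 0" by auto
    then have "card (N r \<inter> U) = 1" using one[of r] by linarith
    ultimately show ?thesis by (metis card_1_singletonE singletonD)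
  qed
  have "stems U \<subseteq> tight U"
    using stem_card_pos one by (auto simp: tight_def intro: antisym)
  then have "{s \<in> stems (U - N w) - tight U. N s \<inter> (N w \<inter> U) \<noteq> {}} = {}"
    using sets_mono(2)[of "U - N w" U] by blast
  then have new0: "card {s \<in> stems (U - N w) - tight U. N s \<inter> (N w \<inter> U) \<noteq> {}} \<le> 0"
    by (simp only: card.empty)
  have gain: "late_pot T (U - N w) + 5 * int (card (N u)) + 6 * int (card (N w \<inter> U)) - 2 * int (card (T \<inter> (N w \<inter> U)))
    + 2 * (if w \<in> stems U then 1 else 0) + (if w \<in> tight U then 1 else 0) - int 0 \<le> late_pot T U"
    by (rule late_gain[OF l K _ _ new0]) (use only u in \<open>auto simp: movers_def\<close>)
  show ?thesis
  proof (cases "card (N u) = 1")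
    case True
    then have "N u = {w}" using wu by (metis card_1_singletonE singletonD)
    then have "w \<in> stems U" using wu by (auto simp: stems_def leaves_def)
    then have "w \<in> tight U" using \<open>stems U \<subseteq> tight U\<close> by blast
    then show ?thesis using gain True c1 \<open>w \<in> stems U\<close> \<open>T \<inter> (N w \<inter> U) = {}\<close> by simp
  next
    case False
    moreover have "card (N u) \<noteq> 0" using wu by auto
    ultimately have "2 \<le> card (N u)" by linarith
    then show ?thesis using gain c1 \<open>T \<inter> (N w \<inter> U) = {}\<close> by (auto split: if_splits)
  qed
qed

lemma late_pot_empty: "late_pot T {} = 0"
  by (simp add: late_pot_def movers_def stems_def tight_def)

text \<open>The credit \<open>c\<close> is the amount by which Staller's next move may fall short of
  14.\<close>

lemma late_staller:
  assumes l: "late T U" and g: "\<And>w. N w \<inter> U \<noteq> {} \<Longrightarrow> late_pot T (U - N w) + 14 \<le> late_pot T U + c"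
    and IH: "\<And>U'. U' \<subset> U \<Longrightarrow> late T U' \<Longrightarrow> affords Dominator (late_pot T U') U'" and c: "0 \<le> c"
  shows "affords Staller (late_pot T U + c) U"
proof (cases "U = {}")
  case True
  then show ?thesis using c late_pot_empty by (auto intro: finished)
next
  case False
  then show ?thesis
  proof (rule staller)
    fix w assume w: "N w \<inter> U \<noteq> {}"
    have "affords Dominator (late_pot T (U - N w)) (U - N w)"
      by (rule IH[OF removal_psubset[OF w] late_mono[OF l]])
    then show "affords Dominator (late_pot T U + c - 14) (U - N w)"
      by (rule affords_mono) (use g[OF w] in simp)
  qed
qed

text \<open>Three stages, each releasing at least 28 per round: 19 + 10 while some stem is not
  tight, then 17 + 11 while a move dominates two vertices, then 14 + 14.\<close>

lemma late_dominator:
  assumes "late T U"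
  shows "affords Dominator (late_pot T U) U"
proof -
  have "finite U" using late_finite[OF assms] .
  then show ?thesis using assms
  proof (induction U rule: finite_psubset_induct)
    case (psubset U)
    note l = psubset.prems
    have IH: "affords Dominator (late_pot T U') U'" if "U' \<subset> U - N w" "late T U'" for w U'
      using psubset.IH[of U'] that by blast
    show ?case
    proof (cases "U = {}")
      case True
      then show ?thesis using late_pot_empty by (auto intro: finished)
    next
      case ne: False
      show ?thesis
      proof (cases "stems U \<subseteq> tight U")
        case False
        then obtain t where t: "t \<in> stems U" "t \<notin> tight U" by blast
        have K: "N t \<inter> U \<noteq> {}" using stem_card_pos[OF t(1)] by auto
        have "affords Staller (late_pot T (U - N t) + 4) (U - N t)"
        proof (rule late_staller[OF late_mono[OF l]])
          fix w assume "N w \<inter> (U - N t) \<noteq> {}"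
          from late_gain_staller(1)[OF late_mono[OF l] this]
          show "late_pot T (U - N t - N w) + 14 \<le> late_pot T (U - N t) + 4" by linarith
        next
          show "affords Dominator (late_pot T U') U'" if "U' \<subset> U - N t" "late T U'" for U'
            using that by (rule IH)
        qed simp
        then show ?thesis by (rule dominator_via[OF K]) (use late_gain_stem[OF l t] in simp)
      next
        case tight: True
        have tight': "stems (U - N w) \<subseteq> tight (U - N w)" for w
        proof
          fix t assume t: "t \<in> stems (U - N w)"
          then have "t \<in> tight U" using tight sets_mono(2)[of "U - N w" U] by blast
          then have "card (N t \<inter> U) = 1" by (simp add: tight_def)
          moreover have "card (N t \<inter> (U - N w)) \<le> card (N t \<inter> U)" by (rule card_mono) auto
          ultimately show "t \<in> tight (U - N w)" using stem_card_pos[OF t] t by (simp add: tight_def)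
        qed
        show ?thesis
        proof (cases "\<exists>w. 2 \<le> card (N w \<inter> U)")
          case True
          then obtain w where w: "2 \<le> card (N w \<inter> U)" by blast
          then have K: "N w \<inter> U \<noteq> {}" by auto
          have "affords Staller (late_pot T (U - N w) + 3) (U - N w)"
          proof (rule late_staller[OF late_mono[OF l]])
            fix x assume "N x \<inter> (U - N w) \<noteq> {}"
            from late_gain_staller(2)[OF late_mono[OF l] this tight']
            show "late_pot T (U - N w - N x) + 14 \<le> late_pot T (U - N w) + 3" by linarith
        next
          show "affords Dominator (late_pot T U') U'" if "U' \<subset> U - N w" "late T U'" for U'
            using that by (rule IH)
        qed simp
          then show ?thesis
            by (rule dominator_via[OF K]) (use late_gain_staller(3)[OF l K tight w] in simp)
        next
          case False
          have one: "card (N w \<inter> U) \<le> 1" for w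
          proof -
            have "\<not> 2 \<le> card (N w \<inter> U)" using False by blast
            then show ?thesis by linarith
          qed
          have "U \<subseteq> V" using l by (simp add: late_def)
          then obtain w where K: "N w \<inter> U \<noteq> {}" using N_meets[OF ne] by blast
          have "affords Staller (late_pot T (U - N w) + 0) (U - N w)"
          proof (rule late_staller[OF late_mono[OF l]])
            fix x assume x: "N x \<inter> (U - N w) \<noteq> {}"
            have "card (N r \<inter> (U - N w)) \<le> 1" for r
            proof -
              have "card (N r \<inter> (U - N w)) \<le> card (N r \<inter> U)" by (rule card_mono) auto
              then show ?thesis using one[of r] by linarith
            qed
            from late_gain_scattered[OF late_mono[OF l] x this]
            show "late_pot T (U - N w - N x) + 14 \<le> late_pot T (U - N w) + 0" by simp
        next
          show "affords Dominator (late_pot T U') U'" if "U' \<subset> U - N w" "late T U'" for U'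
            using that by (rule IH)
        qed simp
          then show ?thesis
            by (rule dominator_via[OF K]) (use late_gain_scattered[OF l K one] in simp)
        qed
      qed
    qed
  qed
qed

section \<open>Dominator's strategy\<close>

lemma pot_initial: "pot V = 11 * int (card V)"
proof -
  have "movers V = V"
  proof
    show "V \<subseteq> movers V" using N_nonempty N_subset unfolding movers_def by blast
  qed (rule movers_sub)
  moreover have "half V = {}" unfolding half_def using stems_sub by blast
  moreover have "charged V = {}"
  proof (rule equals0I)
    fix r assume r: "r \<in> charged V"
    then obtain t where "t \<in> N r" unfolding charged_def by blast
    then show False using r in_V(2) unfolding charged_def by blast
  qed
  ultimately show ?thesis by (simp add: pot_def)
qed

text \<open>The terms for live vertices cancel, and half vertices are tight stems, worth 2 + 1 as in
  \<open>pot\<close>. What is left is the number of tight live vertices, which is at most the number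
  of charged ones.\<close>

lemma late_start:
  assumes U: "U \<subseteq> V"
    and live_apart: "\<And>r t b. t \<in> N r \<Longrightarrow> t \<in> live U \<Longrightarrow> b \<in> N r \<inter> U \<Longrightarrow> b = t"
    and half_tight: "\<And>t b c. t \<in> half U \<Longrightarrow> b \<in> N t \<inter> U \<Longrightarrow> c \<in> N t \<inter> U \<Longrightarrow> b = c"
  shows "late (live U) U" "late_pot (live U) U \<le> pot U"
proof -
  have one: "card (N t \<inter> U) = 1"
    if t: "t \<in> stems U" and eq: "\<And>b c. b \<in> N t \<inter> U \<Longrightarrow> c \<in> N t \<inter> U \<Longrightarrow> b = c" for t
  proof -
    have "card (N t \<inter> U) \<le> 1" using eq by (auto simp: card_le_Suc0_iff_eq)
    then show ?thesis using stem_card_pos[OF t] by simp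
  qed
  have half_sub: "half U \<subseteq> tight U"
    using one half_tight unfolding half_def tight_def by blast
  have meet: "N r \<inter> U = {t}" if "t \<in> live U" "r \<in> N t" for r t
    using live_apart[OF N_sym[OF that(2)] that(1)] N_sym[OF that(2)] that(1)
    by (auto simp: live_def)
  have "2 \<le> card (N t)" if "t \<in> live U" for t
  proof -
    obtain u where u: "u \<in> leaves t" using \<open>t \<in> live U\<close> by (auto simp: live_def stems_def)
    obtain r where r: "r \<in> N t" "r \<noteq> u" using stem_other_nbr[OF u] by blast
    have "card {r, u} \<le> card (N t)" using r leaf_in_N[OF u] by (intro card_mono) auto
    then show ?thesis using r by simp
  qed
  moreover have "N s \<inter> N t = {}" if "s \<in> live U" "t \<in> live U" "s \<noteq> t" for s t
    using meet[OF that(1)] meet[OF that(2)] that(3) by (metis disjoint_iff singleton_inject)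
  moreover have "stems U - tight U \<subseteq> live U" using half_sub unfolding half_def live_def by blast
  ultimately show "late (live U) U" unfolding late_def using U meet by blast
  have LU: "live U \<inter> U = live U" by (auto simp: live_def)
  have st: "card (stems U) = card (live U) + card (half U)"
    using card_Un_disjoint[of "live U" "half U"]
    by (simp add: live_def half_def Int_Diff_Un Int_Diff_disjoint)
  have tt: "card (tight U) = card (tight U \<inter> live U) + card (half U)"
  proof -
    have "tight U = (tight U \<inter> live U) \<union> half U" "(tight U \<inter> live U) \<inter> half U = {}"
      using half_sub unfolding tight_def half_def live_def by blast+
    then show ?thesis using card_Un_disjoint[of "tight U \<inter> live U" "half U"] by simp
  qed
  have "card (tight U \<inter> live U) \<le> card (charged U)"
  proof -
    \<comment> \<open>A neighbor of \<open>t\<close> other than its leaf is charged, and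
      \<open>t\<close> is its only undominated neighbor. So the choice of \<open>r\<close> is
      injective.\<close>
    have "\<exists>r. r \<in> N t \<inter> charged U" if t: "t \<in> tight U" "t \<in> live U" for t
    proof -
      obtain u where u: "u \<in> leaves t" "u \<in> N t \<inter> U"
        using stem_leafE[of t U] t by (metis IntD1 live_def)
      obtain r where r: "r \<in> N t" "r \<noteq> u" using stem_other_nbr[OF u(1)] by blast
      have c: "card (N t \<inter> U) = 1" using t by (simp add: tight_def)
      have "r \<notin> U"
      proof
        assume "r \<in> U"
        then have "{r, u} \<subseteq> N t \<inter> U" using r u by blast
        then have "card {r, u} \<le> card (N t \<inter> U)" by (intro card_mono) auto
        then show False using c r by simp
      qed
      moreover have "r \<notin> stems U"
      proof
        assume "r \<in> stems U"
        then obtain y where y: "y \<in> leaves r" "y \<in> N r \<inter> U" "y \<notin> live U" using stem_leafE by metis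
        then have "y = t" using meet[OF t(2) r(1)] by (metis singletonD)
        then show False using y t by blast
      qed
      moreover have "t \<in> N r \<inter> live U" using N_sym[OF r(1)] t by blast
      ultimately show ?thesis using r(1) unfolding charged_def by blast
    qed
    then have "\<exists>f. \<forall>t \<in> tight U \<inter> live U. f t \<in> N t \<inter> charged U" by (intro bchoice) blast
    then obtain f where f: "\<And>t. t \<in> tight U \<inter> live U \<Longrightarrow> f t \<in> N t \<inter> charged U" by blast
    have "inj_on f (tight U \<inter> live U)"
    proof (rule inj_onI)
      fix x y assume xy: "x \<in> tight U \<inter> live U" "y \<in> tight U \<inter> live U" "f x = f y"
      have "N (f x) \<inter> U = {x}" "N (f y) \<inter> U = {y}"
        using meet[of x "f x"] meet[of y "f y"] f[OF xy(1)] f[OF xy(2)] xy(1,2) by blast+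
      then show "x = y" using xy(3) by (metis singleton_inject)
    qed
    moreover have "f ` (tight U \<inter> live U) \<subseteq> charged U" using f by blast
    ultimately show ?thesis by (rule card_inj_on_le) simp
  qed
  then show "late_pot (live U) U \<le> pot U"
    using st tt unfolding late_pot_def pot_def LU by linarith
qed

text \<open>Two live neighbors would release 5 + 8 + 8, and a half vertex next to a live one 5 + 6 +
  8 + 3.\<close>

lemma live_sparse_if_no_20:
  assumes U: "U \<subseteq> V" and no20: "\<And>w. N w \<inter> U \<noteq> {} \<Longrightarrow> \<not> pot (U - N w) + 20 \<le> pot U"
  shows "live_sparse U" "half_apart U"
proof -
  show "live_sparse U" unfolding live_sparse_def
  proof (intro allI impI, rule ccontr)
    fix x s t assume s: "s \<in> N x \<inter> live U" and t: "t \<in> N x \<inter> live U" and st: "s \<noteq> t"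
    have "s \<in> N x \<inter> U" "t \<in> N x \<inter> U" using s t by (auto simp: live_def)
    from gain2[OF U this st] have "pot (U - N x) + 20 \<le> pot U"
      using val_live s t by (auto split: if_splits)
    then show False using no20[of x] \<open>s \<in> N x \<inter> U\<close> by blast
  qed
  show "half_apart U" unfolding half_apart_def
  proof (intro ballI equals0I)
    fix w t assume w: "w \<in> half U" and t: "t \<in> N w \<inter> live U"
    have "w \<in> stems U" using w by (simp add: half_def)
    then obtain u where u: "u \<in> leaves w" "u \<in> N w \<inter> U" "u \<notin> live U" using stem_leafE by metis
    have tU: "t \<in> N w \<inter> U" "u \<noteq> t" using t u by (auto simp: live_def)
    have "pot (U - N w) + 20 \<le> pot U"
      using gain2[OF U u(2) tU] val_leaf[OF u(1), of U] val_live[of t U w] t w by (simp split: if_splits)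
    then show False using no20[of w] tU by blast
  qed
qed

lemma gain_live_neighbours:
  assumes U: "U \<subseteq> V" and r: "r \<in> stems U" and t: "t \<in> N r" "t \<in> live U"
  shows "pot (U - N r) + 19 \<le> pot U"
proof -
  obtain u where u: "u \<in> leaves r" "u \<in> N r \<inter> U" "u \<notin> live U" using stem_leafE[OF r] by metis
  have tU: "t \<in> N r \<inter> U" "u \<noteq> t" using t u by (auto simp: live_def)
  then show ?thesis
    using gain2[OF U u(2) tU] val_leaf[OF u(1), of U] val_live[of t U r] t by (auto split: if_splits)
qed

lemma dominator_bound:
  assumes "U \<subseteq> V"
  shows "affords Dominator (pot U) U"
  using finite_subset[OF assms finite_V] assms
proof (induction U rule: finite_psubset_induct)
  case (psubset U)
  note U = psubset.prems
  have IH: "affords Dominator (pot U') U'" if "U' \<subset> U" for U'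
    using psubset.IH[OF that] that U by blast
  have IHw: "affords Dominator (pot U') U'" if "U' \<subset> U - N w" for U' w
    using that by (intro IH) blast
  have sub: "U - N w \<subseteq> V" for w using U by blast
  show ?case
  proof (cases "\<exists>w. N w \<inter> U \<noteq> {} \<and> pot (U - N w) + 20 \<le> pot U")
    case True
    then obtain w where w: "N w \<inter> U \<noteq> {}" "pot (U - N w) + 20 \<le> pot U" by blast
    have "affords Staller (pot (U - N w) + 6) (U - N w)" by (rule staller_any[OF sub IHw])
    then show ?thesis by (rule dominator_via[OF w(1)]) (use w(2) in simp)
  next
    case False
    then have no20: "\<not> pot (U - N w) + 20 \<le> pot U" if "N w \<inter> U \<noteq> {}" for w using that by blast
    have p: "live_sparse U" by (rule live_sparse_if_no_20(1)[OF U no20])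
    have h: "half_apart U" by (rule live_sparse_if_no_20(2)[OF U no20])
    have pw: "live_sparse (U - N w)" for w by (rule live_sparse_mono[OF p Diff_subset])
    have via19: ?thesis if w: "N w \<inter> U \<noteq> {}" "pot (U - N w) + 19 \<le> pot U" "half_apart (U - N w)" for w
    proof -
      have "affords Staller (pot (U - N w) + 5) (U - N w)"
        by (rule staller_sparse[OF sub IHw pw w(3)])
      then show ?thesis by (rule dominator_via[OF w(1)]) (use w(2) in simp)
    qed
    show ?thesis
    \<comment> \<open>Adjacent live vertices come first, since there \<open>half_apart\<close> needs
      an argument for the particular move. Otherwise it holds after every move
      (\<open>calm\<close>).\<close>
    proof (cases "\<exists>w t. w \<in> live U \<and> t \<in> N w \<and> t \<in> live U")
      case True
      then obtain w t where w: "w \<in> live U" "t \<in> N w" "t \<in> live U" by blast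
      have "half_apart (U - N w)"
      proof (rule half_apartI_after[OF h])
        fix w' s assume w': "w' \<in> live U" "w' \<notin> U - N w" "w' \<in> stems (U - N w)"
          and s: "s \<in> N w'" "s \<in> live (U - N w)"
        have "w' \<in> N w" using w' by (auto simp: live_def)
        then have "w \<in> N w'" by (rule N_sym)
        moreover have "s \<in> live U" using s sets_mono(3)[of "U - N w" U] by blast
        ultimately have "s = w" using live_sparseD[OF p, of s w' w] s w by blast
        then show False using s mover_not_stem[of w U] by (simp add: live_def)
      qed (rule Diff_subset)
      moreover have "N w \<inter> U \<noteq> {}" using w by (auto simp: live_def)
      moreover have "pot (U - N w) + 19 \<le> pot U"
        using gain_live_neighbours[OF U _ w(2,3)] w(1) by (simp add: live_def)
      ultimately show ?thesis by (intro via19)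
    next
      case False
      then have apart: "\<not> (w \<in> live U \<and> t \<in> N w \<and> t \<in> live U)" for w t by blast
      have calm: "half_apart (U - N w)" for w
      proof (rule half_apartI_after[OF h])
        fix w' s assume "w' \<in> live U" "s \<in> N w'" "s \<in> live (U - N w)"
        then show False using apart[of w' s] sets_mono(3)[of "U - N w" U] by blast
      qed (rule Diff_subset)
      show ?thesis
      proof (cases "\<exists>w. N w \<inter> U \<noteq> {} \<and> pot (U - N w) + 19 \<le> pot U")
        case True
        then show ?thesis using via19 calm by blast
      next
        case False
        then have no19: "\<not> pot (U - N w) + 19 \<le> pot U" if "N w \<inter> U \<noteq> {}" for w using that by blast
        show ?thesis
        proof (cases "\<exists>r t b. t \<in> N r \<and> t \<in> live U \<and> b \<in> N r \<inter> U \<and> b \<noteq> t")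
          case True
          then obtain r t b where t: "t \<in> N r" "t \<in> live U" and b: "b \<in> N r \<inter> U" "b \<noteq> t" by blast
          have tU: "t \<in> N r \<inter> U" using t by (auto simp: live_def)
          have ne: "N r \<inter> U \<noteq> {}" using tU by blast
          have rt: "r \<in> N t" using N_sym[OF t(1)] .
          have gain: "pot (U - N r) + 18 + (if r \<in> charged U then 1 else 0) \<le> pot U"
            using gain2[OF U tU b(1)] b(2) val_live[OF t(2), of r] val_ge[of r U b]
            by (simp split: if_splits)
          \<comment> \<open>If \<open>r\<close> were a stem or charged, its move would release 19.
            So \<open>r\<close> is itself undominated.\<close>
          have rs: "r \<notin> stems U" using gain_live_neighbours[OF U _ t] no19[OF ne] by blast
          have "r \<notin> charged U" using gain no19[OF ne] by auto
          then have rU: "r \<in> U" using rs t unfolding charged_def by blast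
          have rr: "r \<notin> N r" by (rule N_irrefl)
          have lsub: "live (U - N r) \<subseteq> live U" by (rule sets_mono(3)[OF Diff_subset])
          \<comment> \<open>After the move \<open>t\<close> is half and \<open>r\<close> is an
            undominated neighbor of it without live neighbors: this is the reserve of
            \<open>staller_half_reply\<close>.\<close>
          have "affords Staller (pot (U - N r) + 4) (U - N r)"
          proof (rule staller_half_reply[OF sub IHw pw calm])
            have "t \<in> stems U" "t \<noteq> r" using t rr by (auto simp: live_def)
            then show "t \<in> half (U - N r)" using stem_stays[of t U r] t by (simp add: half_def)
            show "r \<in> N t" by (rule rt)
            show "r \<in> U - N r" using rU rr by blast
            show "r \<notin> leaves t" using b t leaf_N[of r t] by auto
            show "r \<notin> live (U - N r)" using rs lsub by (auto simp: live_def)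
            show "N r \<inter> live (U - N r) = {}" by (auto simp: live_def)
          qed
          then show ?thesis by (rule dominator_via[OF ne]) (use gain in \<open>simp split: if_splits\<close>)
        next
          case False
          have half_tight: "b = c" if t: "t \<in> half U" and b: "b \<in> N t \<inter> U" and c: "c \<in> N t \<inter> U" for t b c
          proof (rule ccontr)
            assume bc: "b \<noteq> c"
            have "t \<in> stems U" using t by (simp add: half_def)
            then obtain u where u: "u \<in> leaves t" "u \<in> N t \<inter> U" using stem_leafE by metis
            obtain d where d: "d \<in> N t \<inter> U" "u \<noteq> d" using b c bc by metis
            \<comment> \<open>The half vertex \<open>t\<close> would release 5 + 3, its leaf 6 and
              \<open>d\<close> at least 5.\<close>
            have "pot (U - N t) + 19 \<le> pot U"
              using gain2[OF U u(2) d] val_leaf[OF u(1), of U] val_ge[of t U d] t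
              by (simp split: if_splits)
            then show False using no19[of t] b by blast
          qed
          have live_apart: "b = t" if "t \<in> N r" "t \<in> live U" "b \<in> N r \<inter> U" for r t b
            using that False by blast
          have "late (live U) U" by (rule late_start(1)[OF U live_apart half_tight])
          from late_dominator[OF this] show ?thesis
            by (rule affords_mono) (rule late_start(2)[OF U live_apart half_tight])
        qed
      qed
    qed
  qed
qed

end

section \<open>The game on a graph\<close>

locale component_graph = graph G for G :: "('a, 'b) pre_digraph" +
  assumes large_components: "C \<in> sccs \<Longrightarrow> 3 \<le> card (verts C)"
begin

lemma nbhd_sym: "u \<in> open_nbhd G v \<Longrightarrow> v \<in> open_nbhd G u"
  unfolding open_nbhd_def using arcs_ends_symmetric[OF sym_arcs] by auto

text \<open>Such a set contains the whole component of \<open>v\<close>. Applied to one vertex and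
  to the ends of an edge, this excludes isolated vertices and single-edge components.\<close>

lemma nbhd_closed_large:
  assumes v: "v \<in> verts G" "v \<in> S" and closed: "\<And>x. x \<in> S \<Longrightarrow> open_nbhd G x \<subseteq> S" and S: "finite S"
  shows "3 \<le> card S"
proof -
  have "w \<in> S" if "v \<rightarrow>\<^sup>*\<^bsub>G\<^esub> w" for w
    using that
  proof (induction rule: reachable_induct)
    case base
    show ?case by (rule v)
  next
    case (step x y)
    have "x \<in> open_nbhd G y" using step by (simp add: open_nbhd_def)
    then show ?case using nbhd_sym closed step by blast
  qed
  then have "{w. v \<rightarrow>\<^sup>*\<^bsub>G\<^esub> w} \<subseteq> S" by blast
  then have "card {w. v \<rightarrow>\<^sup>*\<^bsub>G\<^esub> w} \<le> card S" using S by (intro card_mono)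
  moreover have "3 \<le> card {w. v \<rightarrow>\<^sup>*\<^bsub>G\<^esub> w}"
    using large_components[OF induce_reachable_is_in_sccs[OF v(1)]] by simp
  ultimately show ?thesis by simp
qed

sublocale nbhd_system "verts G" "open_nbhd G"
proof
  show "finite (verts G)" by simp
  show sub: "open_nbhd G v \<subseteq> verts G" for v unfolding open_nbhd_def by (auto dest: adj_in_verts)
  show "v \<in> open_nbhd G u" if "u \<in> open_nbhd G v" for u v using that by (rule nbhd_sym)
  show "v \<notin> open_nbhd G v" for v unfolding open_nbhd_def by (auto dest: adj_not_same)
  show "open_nbhd G v \<noteq> {}" if "v \<in> verts G" for v
  proof
    assume "open_nbhd G v = {}"
    then show False using nbhd_closed_large[OF that, of "{v}"] by simp
  qed
  show "open_nbhd G t \<noteq> {v}" if "open_nbhd G v = {t}" for v t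
  proof
    assume t: "open_nbhd G t = {v}"
    then have "v \<in> verts G" using sub[of t] by simp
    from nbhd_closed_large[OF this, of "{v, t}"] have "3 \<le> card {v, t}" using that t by auto
    moreover have "card {v, t} \<le> 2" by (simp add: card_insert_if)
    ultimately show False by simp
  qed
qed

definition undominated :: "'a set \<Rightarrow> 'a set" where
  "undominated D = {u \<in> verts G. \<forall>d \<in> D. u \<notin> open_nbhd G d}"

lemma undominated_insert: "undominated (insert w D) = undominated D - open_nbhd G w"
  by (auto simp: undominated_def)

lemma legal_moves_iff: "w \<in> legal_moves G D \<longleftrightarrow> open_nbhd G w \<inter> undominated D \<noteq> {}"
proof -
  have "w \<in> verts G" if "u \<in> open_nbhd G w" for u using in_V(2)[OF that] .
  then show ?thesis unfolding legal_moves_def totally_dominates_def undominated_def by blast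
qed

lemma undominated_empty_iff:
  "D \<subseteq> verts G \<Longrightarrow> undominated D = {} \<longleftrightarrow> total_dominating_set G D"
  unfolding undominated_def total_dominating_set_def using nbhd_sym by blast

lemma game_length_step:
  assumes D: "D \<subseteq> verts G" and u: "undominated D \<noteq> {}"
  shows "w \<in> legal_moves G D \<Longrightarrow>
      game_length G Dominator D \<le> Suc (game_length G Staller (insert w D))"
    and "\<exists>w \<in> legal_moves G D. game_length G Staller D = Suc (game_length G Dominator (insert w D))"
proof -
  have "legal_moves G D \<noteq> {}"
    using N_meets[OF u] legal_moves_iff unfolding undominated_def by blast
  moreover have "legal_moves G D \<subseteq> verts G" unfolding legal_moves_def by blast
  then have fin: "finite (legal_moves G D)" using finite_V by (rule finite_subset)
  ultimately have *: "game_length G p D = Suc (case p of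
       Dominator \<Rightarrow> (MIN v \<in> legal_moves G D. game_length G Staller (insert v D))
     | Staller \<Rightarrow> (MAX v \<in> legal_moves G D. game_length G Dominator (insert v D)))" for p
    using u undominated_empty_iff[OF D] by (subst game_length.simps) simp
  show "game_length G Dominator D \<le> Suc (game_length G Staller (insert w D))"
    if "w \<in> legal_moves G D"
    using that fin by (simp add: *)
  have "(MAX v \<in> legal_moves G D. game_length G Dominator (insert v D))
      \<in> (\<lambda>v. game_length G Dominator (insert v D)) ` legal_moves G D"
    using fin \<open>legal_moves G D \<noteq> {}\<close> by (intro Max_in) auto
  then show "\<exists>w \<in> legal_moves G D. game_length G Staller D = Suc (game_length G Dominator (insert w D))"
    by (auto simp: *)
qed

text \<open>Dominator's move in the derivation bounds the minimum, and the maximum is attained at a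
  legal move covered by the \<open>staller\<close> premise. \<open>D\<close> stays arbitrary because
  a position records only the undominated vertices.\<close>

lemma affords_game_length:
  assumes "affords p c U" "D \<subseteq> verts G" "undominated D = U"
  shows "14 * int (game_length G p D) \<le> c"
  using assms
proof (induction arbitrary: D rule: affords.induct)
  case (finished c p)
  then show ?case
    using undominated_empty_iff[of D] by (simp add: game_length.simps)
next
  case (dominator w U c)
  have w: "w \<in> legal_moves G D" using dominator by (simp add: legal_moves_iff)
  then have "insert w D \<subseteq> verts G" using dominator by (auto simp: legal_moves_def)
  then have "14 * int (game_length G Staller (insert w D)) \<le> c - 14"
    using dominator by (simp add: undominated_insert)
  then show ?case using game_length_step(1)[of D w] w dominator by fastforce
next
  case (staller U c)
  obtain w where w: "w \<in> legal_moves G D"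
    "game_length G Staller D = Suc (game_length G Dominator (insert w D))"
    using game_length_step(2)[of D] staller by blast
  then have "insert w D \<subseteq> verts G" using staller by (auto simp: legal_moves_def)
  then have "14 * int (game_length G Dominator (insert w D)) \<le> c - 14"
    using staller w by (simp add: undominated_insert legal_moves_iff)
  then show ?case using w(2) by simp
qed

lemma game_total_domination_number_bound:
  "14 * game_total_domination_number G \<le> 11 * card (verts G)"
proof -
  have "undominated {} = verts G" by (simp add: undominated_def)
  from affords_game_length[OF dominator_bound[OF subset_refl] _ this] show ?thesis
    by (simp add: pot_initial game_total_domination_number_def)
qed

end

theorem theorem1:
  fixes G :: "('a, 'b) pre_digraph"
  assumes "graph G"
    and "\<forall>C \<in> pre_digraph.sccs G. 3 \<le> card (verts C)"
  shows "real (game_total_domination_number G) \<le> 11 / 14 * real (card (verts G))"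
proof -
  interpret component_graph G
    using assms by (simp add: component_graph_def component_graph_axioms_def)
  show ?thesis using game_total_domination_number_bound by linarith
qed

end
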